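(* There exist an absolute constant $c>0$ and an integer $n_0$ such that for every integer $n\ge n_0$, every positive integer $k$ with $k\le \exp\!\left(c\frac{n}{\log n}\right)$ belongs to $\mathrm{LE}(n)$; that is, for each such $k$ there is a poset $P$ with exactly $n$ elements and $\mathrm{ext}(P)=k$.
   Context: All posets are finite. For a finite poset $P$, $\mathrm{ext}(P)$ denotes the number of linear extensions of $P$ (total orders on the ground set of $P$ that extend the partial order). For a positive integer $n$, $\mathrm{LE}(n)=\{\mathrm{ext}(P): P \text{ a poset with } |P|=n\}$. Logarithms are natural. *)

theory Defs
  imports "HOL-Analysis.Analysis"
begin

definition is_poset :: "'a set \<Rightarrow> 'a rel \<Rightarrow> bool" where
  "is_poset A R \<longleftrightarrow> finite A \<and> R \<subseteq> A \<times> A \<and> partial_order_on A R"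

definition linear_extensions :: "'a set \<Rightarrow> 'a rel \<Rightarrow> 'a rel set" where
  "linear_extensions A R = {L. L \<subseteq> A \<times> A \<and> linear_order_on A L \<and> R \<subseteq> L}"

definition ext :: "'a set \<Rightarrow> 'a rel \<Rightarrow> nat" where
  "ext A R = card (linear_extensions A R)"

text \<open>LE(n): numbers of linear extensions of posets on n elements. Every n-element
  poset is isomorphic to one on {0..<n}, so we take the ground set {0..<n}.\<close>

definition LE :: "nat \<Rightarrow> nat set" where
  "LE n = {ext {0..<n} R | R. is_poset {0..<n} R}"

end

theory Submission
  imports Defs "HOL-Computational_Algebra.Primes"
begin

text \<open>Let \<open>x\<close> be a minimal element of a poset \<open>P\<close>, and put \<open>a = ext(P)\<close>, \<open>b = ext(P - x)\<close>. Adding an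
  element \<open>y\<close> below everything except \<open>x\<close> gives a poset with \<open>a + b\<close> linear extensions, from which
  the deletion of \<open>x\<close> leaves \<open>b\<close> and the deletion of \<open>y\<close> leaves \<open>a\<close>. Running the Euclidean algorithm
  for \<open>p\<close> and \<open>m\<close> backwards therefore multiplies the number of linear extensions by \<open>p\<close> at the cost
  of as many new elements as the sum of the partial quotients of \<open>p/m\<close>.

  For a prime \<open>p\<close> some \<open>m\<close> makes this sum \<open>O(ln p ln ln p)\<close>. A partial quotient \<open>a\<close> comes with a pair
  \<open>(w, z)\<close> of positive integers such that \<open>z \<equiv> \<plusminus> w m (mod p)\<close> and \<open>a \<le> p / (w z)\<close>, and each pair
  belongs to at most two \<open>m\<close>. There are about \<open>(p / A) ln p\<close> pairs with \<open>w z \<le> p / A\<close>, so for \<open>A\<close> a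
  large multiple of \<open>ln p\<close> a positive proportion of the \<open>m\<close> avoid them. Over those \<open>m\<close> the quotient sum
  averages to at most a constant times the sum of \<open>1 / (w z)\<close> over \<open>p / A < w z < p\<close>, which is
  \<open>O(ln p ln A)\<close>. Adding these costs over the prime factors of \<open>k\<close> gives the theorem.\<close>

section \<open>Adjoining minimal elements to a poset\<close>

text \<open>Deleting \<open>z\<close> and putting it back at the bottom are mutually inverse.
  Minimality of \<open>z\<close> in \<open>R\<close> is what lets the order with \<open>z\<close>
  put back still contain \<open>R\<close>.\<close>

lemma ext_with_bottom:
  assumes "z \<in> A" and min: "\<And>w. (w, z) \<in> R \<Longrightarrow> w = z" and RA: "R \<subseteq> A \<times> A"
  shows "card {L \<in> linear_extensions A R. \<forall>a\<in>A. (z, a) \<in> L} =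
    ext (A - {z}) (Restr R (A - {z}))"
  unfolding ext_def
proof (rule bij_betw_same_card)
  let ?B = "A - {z}"
  show "bij_betw (\<lambda>L. Restr L ?B)
    {L \<in> linear_extensions A R. \<forall>a\<in>A. (z, a) \<in> L} (linear_extensions ?B (Restr R ?B))"
  proof (rule bij_betw_byWitness[where f' = "\<lambda>M. M \<union> {z} \<times> A"])
    show "\<forall>L\<in>{L \<in> linear_extensions A R. \<forall>a\<in>A. (z, a) \<in> L}. Restr L ?B \<union> {z} \<times> A = L"
      unfolding linear_extensions_def linear_order_on_def partial_order_on_def antisym_def
      by blast
    show "\<forall>M\<in>linear_extensions ?B (Restr R ?B). Restr (M \<union> {z} \<times> A) ?B = M"
      unfolding linear_extensions_def by blast
    show "(\<lambda>L. Restr L ?B) ` {L \<in> linear_extensions A R. \<forall>a\<in>A. (z, a) \<in> L}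
      \<subseteq> linear_extensions ?B (Restr R ?B)"
      unfolding linear_extensions_def linear_order_on_def partial_order_on_def preorder_on_def
        refl_on_def trans_def antisym_def total_on_def
      by blast
    show "(\<lambda>M. M \<union> {z} \<times> A) ` linear_extensions ?B (Restr R ?B)
      \<subseteq> {L \<in> linear_extensions A R. \<forall>a\<in>A. (z, a) \<in> L}"
    proof
      fix L assume "L \<in> (\<lambda>M. M \<union> {z} \<times> A) ` linear_extensions ?B (Restr R ?B)"
      then obtain M where L: "L = M \<union> {z} \<times> A" and M: "M \<subseteq> ?B \<times> ?B" "refl_on ?B M" "trans M"
        "antisym M" "total_on ?B M" "Restr R ?B \<subseteq> M"
        unfolding linear_extensions_def linear_order_on_def partial_order_on_def preorder_on_def
        by blast
      have "L \<subseteq> A \<times> A" using L M(1) assms(1) by blast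
      moreover have "refl_on A L" using L M(2) by (auto simp: refl_on_def)
      moreover have "trans L" using L M(1,3) unfolding trans_def by blast
      moreover have "antisym L" using L M(1,4) unfolding antisym_def by blast
      moreover have "total_on A L" using L M(5) unfolding total_on_def by blast
      moreover have "R \<subseteq> L"
      proof (rule subrelI)
        fix a b assume "(a, b) \<in> R"
        then show "(a, b) \<in> L" using L M(6) RA min by (cases "a = z"; cases "b = z") auto
      qed
      moreover have "\<forall>a\<in>A. (z, a) \<in> L" using L by blast
      ultimately show "L \<in> {L \<in> linear_extensions A R. \<forall>a\<in>A. (z, a) \<in> L}"
        unfolding linear_extensions_def linear_order_on_def partial_order_on_def preorder_on_def
        by blast
    qed
  qed
qed

lemma is_poset_add_bottom:
  assumes "is_poset A R" "y \<notin> A"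
  shows "is_poset (insert y A) (R \<union> {y} \<times> insert y A)"
proof -
  have P: "finite A" "R \<subseteq> A \<times> A" "refl_on A R" "trans R" "antisym R"
    using assms unfolding is_poset_def partial_order_on_def preorder_on_def by auto
  have "refl_on (insert y A) (R \<union> {y} \<times> insert y A)" using P(3) by (auto simp: refl_on_def)
  moreover have "trans (R \<union> {y} \<times> insert y A)" using P(2,4) assms(2) unfolding trans_def by blast
  moreover have "antisym (R \<union> {y} \<times> insert y A)" using P(2,5) assms(2) unfolding antisym_def by blast
  ultimately show ?thesis
    using P(1,2) unfolding is_poset_def partial_order_on_def preorder_on_def by blast
qed

lemma ext_add_bottom:
  assumes "R \<subseteq> A \<times> A" "y \<notin> A"
  shows "ext (insert y A) (R \<union> {y} \<times> insert y A) = ext A R"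
proof -
  let ?R = "R \<union> {y} \<times> insert y A"
  have "ext (insert y A) ?R =
      card {L \<in> linear_extensions (insert y A) ?R. \<forall>a\<in>insert y A. (y, a) \<in> L}"
    unfolding ext_def linear_extensions_def by (rule arg_cong[where f = card]) blast
  also have "\<dots> = ext (insert y A - {y}) (Restr ?R (insert y A - {y}))"
    by (rule ext_with_bottom) (use assms in auto)
  also have "insert y A - {y} = A" using assms(2) by blast
  also have "Restr ?R A = R" using assms by blast
  finally show ?thesis .
qed

text \<open>Transitivity could fail only along a chain from \<open>y\<close> through some
  \<open>b\<close> to \<open>x\<close>. Minimality of \<open>x\<close> forces \<open>b = x\<close>,
  and \<open>y\<close> is not below \<open>x\<close>.\<close>

lemma is_poset_add_below_all_but:
  assumes "is_poset A R" "y \<notin> A" "x \<in> A" and min: "\<And>w. (w, x) \<in> R \<Longrightarrow> w = x"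
  shows "is_poset (insert y A) (R \<union> {y} \<times> (insert y A - {x}))"
proof -
  let ?R = "R \<union> {y} \<times> (insert y A - {x})"
  have P: "finite A" "R \<subseteq> A \<times> A" "refl_on A R" "trans R" "antisym R"
    using assms unfolding is_poset_def partial_order_on_def preorder_on_def by auto
  have "refl_on (insert y A) ?R" using P(3) assms(2,3) by (auto simp: refl_on_def)
  moreover have "trans ?R"
  proof (rule transI)
    fix a b c assume "(a, b) \<in> ?R" "(b, c) \<in> ?R"
    then show "(a, c) \<in> ?R"
      using P(2) transD[OF P(4), of a b c] assms(2) min[of b] by (cases "a = y") auto
  qed
  moreover have "antisym ?R" using P(2,5) assms(2) unfolding antisym_def by blast
  ultimately show ?thesis
    using P(1,2) unfolding is_poset_def partial_order_on_def preorder_on_def by blast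
qed

lemma finite_linear_extensions: "finite A \<Longrightarrow> finite (linear_extensions A R)"
  by (rule finite_subset[of _ "Pow (A \<times> A)"]) (auto simp: linear_extensions_def)

text \<open>The least element of a linear extension is either \<open>y\<close> or \<open>x\<close>.\<close>

lemma ext_add_below_all_but:
  assumes "is_poset A R" "y \<notin> A" "x \<in> A" and min: "\<And>w. (w, x) \<in> R \<Longrightarrow> w = x"
  shows "ext (insert y A) (R \<union> {y} \<times> (insert y A - {x})) =
    ext A R + ext (A - {x}) (Restr R (A - {x}))"
proof -
  let ?A = "insert y A" and ?R = "R \<union> {y} \<times> (insert y A - {x})"
  let ?E = "\<lambda>z. {L \<in> linear_extensions ?A ?R. \<forall>a\<in>?A. (z, a) \<in> L}"
  have RA: "R \<subseteq> A \<times> A" and fin: "finite A" using assms(1) by (auto simp: is_poset_def)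
  have "x \<noteq> y" using assms(2,3) by blast
  have "linear_extensions ?A ?R \<subseteq> ?E x \<union> ?E y"
  proof
    fix L assume L: "L \<in> linear_extensions ?A ?R"
    then have tot: "total_on ?A L" and rfl: "refl_on ?A L" and tr: "trans L" and sub: "?R \<subseteq> L"
      by (auto simp: linear_extensions_def linear_order_on_def partial_order_on_def preorder_on_def)
    have ya: "(y, a) \<in> L" if "a \<in> ?A" "a \<noteq> x" for a using sub that by blast
    have "(x, y) \<in> L \<or> (y, x) \<in> L"
      using tot \<open>x \<noteq> y\<close> assms(3) by (auto simp: total_on_def)
    then show "L \<in> ?E x \<union> ?E y"
    proof
      assume "(x, y) \<in> L"
      then have "\<forall>a\<in>?A. (x, a) \<in> L"
        using ya tr rfl assms(3) unfolding trans_def refl_on_def by blast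
      then show ?thesis using L by blast
    next
      assume "(y, x) \<in> L"
      then have "\<forall>a\<in>?A. (y, a) \<in> L" using ya by blast
      then show ?thesis using L by blast
    qed
  qed
  then have un: "linear_extensions ?A ?R = ?E x \<union> ?E y" by blast
  have "L \<notin> ?E y" if L: "L \<in> ?E x" for L
  proof
    assume "L \<in> ?E y"
    then have "(x, y) \<in> L" "(y, x) \<in> L" "antisym L"
      using L assms(3)
      by (auto simp: linear_extensions_def linear_order_on_def partial_order_on_def)
    then show False using \<open>x \<noteq> y\<close> by (auto dest: antisymD)
  qed
  then have "?E x \<inter> ?E y = {}" by blast
  then have "ext ?A ?R = card (?E x) + card (?E y)"
    unfolding ext_def
    by (subst un, intro card_Un_disjoint) (use finite_linear_extensions[of ?A ?R] fin in auto)
  moreover have "card (?E y) = ext (?A - {y}) (Restr ?R (?A - {y}))"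
    by (rule ext_with_bottom) (use RA assms(2) in auto)
  moreover have "?A - {y} = A" "Restr ?R A = R" using assms(2) RA by blast+
  moreover have "card (?E x) = ext (?A - {x}) (Restr ?R (?A - {x}))"
    by (rule ext_with_bottom) (use RA assms(2,3) \<open>x \<noteq> y\<close> min in auto)
  moreover have "?A - {x} = insert y (A - {x})" using \<open>x \<noteq> y\<close> by blast
  moreover have "Restr ?R (insert y (A - {x})) = Restr R (A - {x}) \<union> {y} \<times> insert y (A - {x})"
    using \<open>x \<noteq> y\<close> assms(2) RA by blast
  moreover have "ext (insert y (A - {x})) (Restr R (A - {x}) \<union> {y} \<times> insert y (A - {x}))
      = ext (A - {x}) (Restr R (A - {x}))"
    by (rule ext_add_bottom) (use assms(2) in auto)
  ultimately show ?thesis by simp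
qed

section \<open>The Euclidean algorithm run backwards\<close>

text \<open>By \<open>ext_pair_step\<close> the pairs \<open>(a, b)\<close> are closed under the two moves that undo a step of the
  subtractive Euclidean algorithm.\<close>

definition ext_pair :: "nat \<Rightarrow> nat \<Rightarrow> nat \<Rightarrow> bool" where
  "ext_pair n a b \<longleftrightarrow> (\<exists>R. \<exists>x<n. is_poset {0..<n} R \<and> (\<forall>w. (w, x) \<in> R \<longrightarrow> w = x) \<and>
     ext {0..<n} R = a \<and> ext ({0..<n} - {x}) (Restr R ({0..<n} - {x})) = b)"

lemma ext_pair_LE: "ext_pair n a b \<Longrightarrow> a \<in> LE n"
  unfolding ext_pair_def LE_def by blast

text \<open>A new bottom element leaves the count unchanged, and deleting it gives back the old
  poset. The pair \<open>(k, k)\<close> is where the reversed Euclidean algorithm starts.\<close>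

lemma ext_pair_start:
  assumes "k \<in> LE n"
  shows "ext_pair (Suc n) k k"
proof -
  obtain R where R: "is_poset {0..<n} R" "ext {0..<n} R = k"
    using assms by (auto simp: LE_def)
  let ?R = "R \<union> {n} \<times> insert n {0..<n}"
  have S: "{0..<Suc n} = insert n {0..<n}" by auto
  have sub: "R \<subseteq> {0..<n} \<times> {0..<n}" using R(1) by (simp add: is_poset_def)
  have "insert n {0..<n} - {n} = {0..<n}" "Restr ?R {0..<n} = R" using sub by auto
  then show ?thesis
    unfolding ext_pair_def S
    using is_poset_add_bottom[OF R(1), of n] ext_add_bottom[OF sub, of n] R(2) sub
    by (intro exI[of _ ?R] exI[of _ n]) auto
qed

lemma LE_Suc: "k \<in> LE n \<Longrightarrow> k \<in> LE (Suc n)"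
  by (rule ext_pair_LE[OF ext_pair_start])

lemma LE_mono: "m \<le> n \<Longrightarrow> k \<in> LE m \<Longrightarrow> k \<in> LE n"
  by (induction rule: dec_induct) (auto intro: LE_Suc)

lemma one_in_LE: "1 \<in> LE n"
proof -
  have "linear_extensions {} {} = {{} :: nat rel}"
    by (auto simp: linear_extensions_def)
  then have "ext {0..<0} ({} :: nat rel) = 1" by (simp add: ext_def)
  moreover have "is_poset {0..<0} ({} :: nat rel)" by (simp add: is_poset_def)
  ultimately have "1 \<in> LE 0" unfolding LE_def by (metis (mono_tags, lifting) mem_Collect_eq)
  then show ?thesis using LE_mono by blast
qed

lemma ext_pair_step:
  assumes "ext_pair n a b"
  shows "ext_pair (Suc n) (a + b) b" "ext_pair (Suc n) (a + b) a"
proof -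
  obtain R x where x: "x < n" and R: "is_poset {0..<n} R" and min: "\<And>w. (w, x) \<in> R \<Longrightarrow> w = x"
    and a: "ext {0..<n} R = a" and b: "ext ({0..<n} - {x}) (Restr R ({0..<n} - {x})) = b"
    using assms unfolding ext_pair_def by blast
  let ?A = "insert n {0..<n}" and ?R = "R \<union> {n} \<times> (insert n {0..<n} - {x})"
  have S: "{0..<Suc n} = ?A" by auto
  have sub: "R \<subseteq> {0..<n} \<times> {0..<n}" using R by (simp add: is_poset_def)
  have P: "is_poset ?A ?R" by (rule is_poset_add_below_all_but[OF R]) (use x min in auto)
  have E: "ext ?A ?R = a + b"
    unfolding a[symmetric] b[symmetric]
    by (rule ext_add_below_all_but[OF R]) (use x min in auto)
  have "?A - {x} = insert n ({0..<n} - {x})" using x by auto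
  moreover have "Restr ?R (insert n ({0..<n} - {x})) =
      Restr R ({0..<n} - {x}) \<union> {n} \<times> insert n ({0..<n} - {x})"
    using x sub by auto
  ultimately have "ext (?A - {x}) (Restr ?R (?A - {x})) = b"
    using ext_add_bottom[of "Restr R ({0..<n} - {x})" "{0..<n} - {x}" n] b by simp
  then show "ext_pair (Suc n) (a + b) b"
    unfolding ext_pair_def S using P E x min
    by (intro exI[of _ ?R] exI[of _ x]) auto
  have "?A - {n} = {0..<n}" "Restr ?R {0..<n} = R" using sub by auto
  then have "ext (?A - {n}) (Restr ?R (?A - {n})) = a" using a by simp
  then show "ext_pair (Suc n) (a + b) a"
    unfolding ext_pair_def S using P E x sub
    by (intro exI[of _ ?R] exI[of _ n]) auto
qed

lemma ext_pair_steps: "ext_pair n a b \<Longrightarrow> ext_pair (n + j) (a + j * b) b"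
proof (induction j)
  case (Suc j)
  from ext_pair_step(1)[OF Suc.IH[OF Suc.prems]] show ?case by (simp add: algebra_simps)
qed simp

text \<open>The sum of the partial quotients of the continued fraction of \<open>x / y\<close>, that
  is, the number of subtractions in the subtractive Euclidean algorithm.\<close>

fun quotient_sum :: "nat \<Rightarrow> nat \<Rightarrow> nat" where
  "quotient_sum x y = (if y = 0 then 0 else x div y + quotient_sum y (x mod y))"

declare quotient_sum.simps [simp del]

lemma quotient_sum_0 [simp]: "quotient_sum x 0 = 0"
  by (simp add: quotient_sum.simps)

lemma ext_pair_coprime:
  assumes "k \<in> LE n" "coprime x y" "0 < y" "y \<le> x"
  shows "ext_pair (n + quotient_sum x y) (k * x) (k * y)"
  using assms(2-4)
proof (induction x y rule: quotient_sum.induct)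
  case (1 x y)
  let ?z = "x mod y"
  have q: "x div y > 0" using 1 by (simp add: div_greater_zero_iff)
  show ?case
  proof (cases "?z = 0")
    case True
    then have "y dvd x" by auto
    then have "y = 1" using 1(2) by (simp add: coprime_absorb_right)
    \<comment> \<open>The last quotient is \<open>x\<close> itself: the bottom element of the
      starting pair pays for one unit, and \<open>x - 1\<close> moves pay for the rest.\<close>
    then show ?thesis
      using ext_pair_steps[OF ext_pair_start[OF assms(1)], of "x - 1"] q
      by (simp add: quotient_sum.simps[of x] algebra_simps)
  next
    case False
    have "coprime y ?z" using 1(2) by (metis coprime_iff_gcd_eq_1 gcd.commute gcd_red_nat)
    then have "ext_pair (n + quotient_sum y ?z) (k * y) (k * ?z)"
      using 1 False by (simp add: less_imp_le)
    \<comment> \<open>Undoing a division with quotient \<open>a\<close> takes one move that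
      exchanges the roles of the components, then \<open>a - 1\<close> moves that keep the second
      one.\<close>
    from ext_pair_steps[OF ext_pair_step(2)[OF this], of "x div y - 1"]
    have "ext_pair (Suc (n + quotient_sum y ?z) + (x div y - 1))
      (k * y + k * ?z + (x div y - 1) * (k * y)) (k * y)" .
    moreover have "Suc (n + quotient_sum y ?z) + (x div y - 1) = n + quotient_sum x y"
      using q 1(3) by (simp add: quotient_sum.simps[of x])
    moreover have "k * y + k * ?z + (x div y - 1) * (k * y) = k * x"
    proof -
      obtain j where j: "x div y = Suc j" using q by (metis Suc_pred)
      then have "x = y + j * y + ?z" using div_mult_mod_eq[of x y] by simp
      then have "k * x = k * (y + j * y + ?z)" by (rule arg_cong)
      then show ?thesis using j by (simp add: algebra_simps)
    qed
    ultimately show ?thesis by (simp only:)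
  qed
qed

lemma LE_mult:
  assumes "k \<in> LE n" "coprime x y" "0 < y" "y \<le> x"
  shows "k * x \<in> LE (n + quotient_sum x y)"
  using ext_pair_coprime[OF assms] by (rule ext_pair_LE)

section \<open>Partial quotients and approximation pairs\<close>

text \<open>The pairs \<open>(w, z)\<close> run through the denominators \<open>w\<close> of the convergents of \<open>m/p\<close> and the
  corresponding remainders \<open>z \<equiv> \<plusminus> w m (mod p)\<close>, for which the next partial quotient is at most
  \<open>p / (w z)\<close>.\<close>

definition approx_pair :: "nat \<Rightarrow> nat \<Rightarrow> nat \<times> nat \<Rightarrow> bool" where
  "approx_pair p m = (\<lambda>(w, z). int p dvd int z + int w * int m \<or> int p dvd int z - int w * int m)"

definition hyperbola :: "nat \<Rightarrow> (nat \<times> nat) set" where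
  "hyperbola p = {(w, z). 0 < w \<and> 0 < z \<and> w * z < p}"

lemma hyperbola_subset: "hyperbola p \<subseteq> {1..<p} \<times> {1..<p}"
proof (rule subrelI)
  fix w z assume "(w, z) \<in> hyperbola p"
  then have wz: "0 < w" "0 < z" "w * z < p" by (simp_all add: hyperbola_def)
  then have "w \<le> w * z" "z \<le> w * z" by simp_all
  with wz(3) have "w < p" "z < p" by linarith+
  with wz(1,2) show "(w, z) \<in> {1..<p} \<times> {1..<p}" by simp
qed

lemma finite_hyperbola: "finite (hyperbola p)"
  by (rule finite_subset[OF hyperbola_subset]) auto

text \<open>Here \<open>x\<close>, \<open>y\<close> are consecutive remainders, \<open>u\<close>,
  \<open>v\<close> the absolute values of their cofactors of \<open>m\<close>, and \<open>s\<close>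
  the alternating sign. The determinant identity \<open>x * v + y * u = p\<close> gives
  \<open>v * x \<le> p\<close>, so the quotient \<open>x div y\<close> is at most
  \<open>p / (v * y)\<close>.\<close>

lemma quotient_sum_le_invariant:
  fixes s :: int
  assumes "s = 1 \<or> s = -1" "y < x" "x * v + y * u = p" "0 < v"
    "int p dvd int y + s * int v * int m" "int p dvd int x - s * int u * int m"
  shows "real (quotient_sum x y) \<le>
    (\<Sum>(w, z)\<in>{(w, z) \<in> hyperbola p. approx_pair p m (w, z) \<and> z \<le> y}. real p / (real w * real z))"
  using assms
proof (induction x y arbitrary: u v s rule: quotient_sum.induct)
  case (1 x y)
  let ?f = "\<lambda>(w, z). real p / (real w * real z)"
  let ?T = "\<lambda>y. {(w, z) \<in> hyperbola p. approx_pair p m (w, z) \<and> z \<le> y}"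
  have fin: "finite (?T y)" for y by (rule finite_subset[OF _ finite_hyperbola]) auto
  show ?case
  proof (cases "y = 0")
    case True
    then show ?thesis by (auto intro!: sum_nonneg)
  next
    case False
    let ?a = "x div y" and ?z = "x mod y"
    have "y * (u + ?a * v) + ?z * v = (?a * y + ?z) * v + y * u"
      by (simp only: algebra_simps)
    also have "\<dots> = p" using "1.prems"(3) by simp
    finally have inv: "y * (u + ?a * v) + ?z * v = p" .
    have zx: "int ?z = int x - int ?a * int y"
      by (metis add_diff_cancel_left' div_mult_mod_eq of_nat_add of_nat_mult)
    have "int ?z + (-s) * int (u + ?a * v) * int m =
        (int x - s * int u * int m) - int ?a * (int y + s * int v * int m)"
      unfolding zx by (simp add: algebra_simps)
    then have d1: "int p dvd int ?z + (-s) * int (u + ?a * v) * int m"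
      using "1.prems"(5,6) by (metis dvd_diff dvd_mult)
    have d2: "int p dvd int y - (-s) * int v * int m" using "1.prems"(5) by simp
    have "0 < ?a" using "1.prems"(2) False by (simp add: div_greater_zero_iff)
    then have IH: "real (quotient_sum y ?z) \<le> sum ?f (?T ?z)"
      using "1.IH"[OF False, of "-s" "u + ?a * v" v] "1.prems"(1,4) False inv d1 d2 by auto
    have "v * x \<le> p" using "1.prems"(3) by (metis le_add1 mult.commute)
    moreover have "v * y < v * x" using "1.prems"(2,4) by simp
    ultimately have "v * y < p" by (rule less_le_trans[rotated])
    then have "(v, y) \<in> hyperbola p" using "1.prems"(4) False by (simp add: hyperbola_def)
    moreover have "approx_pair p m (v, y)"
      using "1.prems"(1,5) by (auto simp: approx_pair_def)
    ultimately have ins: "insert (v, y) (?T ?z) \<subseteq> ?T y"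
      using False by (auto intro: order.trans[OF _ mod_le_divisor])
    \<comment> \<open>Later pairs have second component at most \<open>x mod y < y\<close>, so the
      current pair is new and its term is not counted twice.\<close>
    have nin: "(v, y) \<notin> ?T ?z" using False by (simp add: not_le)
    have "real ?a \<le> real x / real y" by (rule of_nat_div_le_of_nat)
    also have "\<dots> \<le> ?f (v, y)"
    proof -
      have "real v * real x \<le> real p" using \<open>v * x \<le> p\<close> by (metis of_nat_le_iff of_nat_mult)
      then show ?thesis using False "1.prems"(4) by (simp add: field_simps)
    qed
    finally have "real (quotient_sum x y) \<le> ?f (v, y) + sum ?f (?T ?z)"
      using IH False by (simp add: quotient_sum.simps[of x y])
    also have "\<dots> = sum ?f (insert (v, y) (?T ?z))"
      using nin by (subst sum.insert[OF fin]) auto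
    also have "\<dots> \<le> sum ?f (?T y)"
      by (rule sum_mono2[OF fin ins]) auto
    finally show ?thesis .
  qed
qed

lemma quotient_sum_le:
  assumes "m < p"
  shows "real (quotient_sum p m) \<le>
    (\<Sum>(w, z)\<in>{q \<in> hyperbola p. approx_pair p m q}. real p / (real w * real z))"
proof -
  have "real (quotient_sum p m) \<le>
    (\<Sum>(w, z)\<in>{(w, z) \<in> hyperbola p. approx_pair p m (w, z) \<and> z \<le> m}. real p / (real w * real z))"
    \<comment> \<open>At the start the remainders \<open>p\<close> and \<open>m\<close> have
      cofactors 0 and 1.\<close>
    by (rule quotient_sum_le_invariant[of "-1" _ _ 1 0]) (use assms in auto)
  also have "\<dots> \<le> (\<Sum>(w, z)\<in>{q \<in> hyperbola p. approx_pair p m q}. real p / (real w * real z))"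
    by (rule sum_mono2) (use finite_hyperbola in auto)
  finally show ?thesis .
qed

lemma prime_dvd_mult_diff_imp_eq:
  fixes p w m m' :: nat
  assumes "prime p" "0 < w" "w < p" "m < p" "m' < p" "int p dvd int w * (int m - int m')"
  shows "m = m'"
proof -
  have "\<not> int p dvd int w" using assms(2,3) by (simp add: nat_dvd_not_less)
  then have "int p dvd int m - int m'"
    using assms(1,6) by (meson prime_dvd_multD prime_nat_int_transfer)
  then have "int m mod int p = int m' mod int p" by (simp add: mod_eq_dvd_iff)
  then show ?thesis using assms(4,5) by simp
qed

text \<open>Each of the two signs gives a linear congruence for \<open>m\<close> whose coefficient
  \<open>w\<close> is invertible modulo \<open>p\<close>, hence at most one solution.\<close>

lemma card_approx_pair_le:
  assumes "prime p" "q \<in> hyperbola p"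
  shows "card {m \<in> {1..<p}. approx_pair p m q} \<le> 2"
proof -
  obtain w z where q: "q = (w, z)" by fastforce
  have w: "0 < w" "w < p" using assms(2) hyperbola_subset[of p] by (auto simp: q)
  define S where "S s = {m \<in> {1..<p}. int p dvd int z + s * int w * int m}" for s :: int
  have "card (S s) \<le> Suc 0" if s: "s = 1 \<or> s = -1" for s
  proof (subst card_le_Suc0_iff_eq)
    show "finite (S s)" by (simp add: S_def)
    show "\<forall>m\<in>S s. \<forall>m'\<in>S s. m = m'"
    proof (intro ballI)
      fix m m' assume "m \<in> S s" "m' \<in> S s"
      then have "int p dvd (int z + s * int w * int m) - (int z + s * int w * int m')"
        and lt: "m < p" "m' < p" unfolding S_def by (blast intro: dvd_diff, auto)
      then have "int p dvd s * (int w * (int m - int m'))" by (simp add: algebra_simps)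
      then have "int p dvd int w * (int m - int m')" using s by auto
      then show "m = m'" using prime_dvd_mult_diff_imp_eq[OF assms(1) w lt] by blast
    qed
  qed
  from this[of 1] this[of "-1"] have "card (S 1) + card (S (-1)) \<le> 2" by simp
  moreover have "{m \<in> {1..<p}. approx_pair p m q} = S 1 \<union> S (-1)"
    by (auto simp: S_def approx_pair_def q)
  ultimately show ?thesis by (metis card_Un_le le_trans)
qed

section \<open>Harmonic sums over the hyperbola\<close>

text \<open>The first term is at most 1, and each later term \<open>1 / (t + 1)\<close> is at most
  the increment of the logarithm, by \<open>ln x \<le> x - 1\<close> at
  \<open>x = t / (t + 1)\<close>.\<close>

lemma sum_inverse_interval_le:
  assumes "1 \<le> s" "s \<le> t"
  shows "(\<Sum>r\<in>{s..t}. 1 / real r) \<le> 1 + ln (real t / real s)"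
  using assms(2)
proof (induction rule: dec_induct)
  case base
  then show ?case using assms(1) by simp
next
  case (step t)
  have t: "0 < t" using step assms(1) by simp
  have "ln (real t / real (Suc t)) \<le> real t / real (Suc t) - 1"
    by (rule ln_le_minus_one) (use t in simp)
  also have "\<dots> = - (1 / real (Suc t))" by (simp add: field_simps)
  finally have "1 / real (Suc t) \<le> ln (real (Suc t) / real s) - ln (real t / real s)"
    using t assms(1) by (simp add: ln_div)
  moreover have "{s..Suc t} = insert (Suc t) {s..t}" using step by auto
  ultimately show ?case using step.IH by simp
qed

lemma sum_inverse_between_le:
  fixes a b :: real
  assumes "0 < a" "a \<le> b"
  shows "(\<Sum>r\<in>{r. a < real r \<and> real r \<le> b}. 1 / real r) \<le> 1 + ln (b / a)"
proof -
  define s t where "s = Suc (nat \<lfloor>a\<rfloor>)" and "t = nat \<lfloor>b\<rfloor>"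
  have eq: "{r. a < real r \<and> real r \<le> b} = {s..t}"
    using assms by (auto simp: s_def t_def Suc_le_eq floor_less_iff nat_less_iff le_nat_floor le_nat_iff le_floor_iff)
  show ?thesis
  proof (cases "s \<le> t")
    case True
    then have "s \<in> {s..t}" "t \<in> {s..t}" by auto
    then have "a < real s" "real t \<le> b" unfolding eq[symmetric] by blast+
    moreover have "0 < s" "0 < t" using True by (auto simp: s_def)
    ultimately have "real t / real s \<le> b / a" using assms by (intro frac_le) auto
    then have "ln (real t / real s) \<le> ln (b / a)"
      using \<open>0 < s\<close> \<open>0 < t\<close> by (intro ln_mono) auto
    then show ?thesis unfolding eq using sum_inverse_interval_le[OF _ True] \<open>0 < s\<close> by simp
  next
    case False
    then have "{s..t} = {}" by simp
    then show ?thesis unfolding eq using assms by (simp add: ln_ge_zero)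
  qed
qed

lemma sum_inverse_lessThan_le:
  assumes "2 \<le> p"
  shows "(\<Sum>w\<in>{1..<p}. 1 / real w) \<le> 1 + ln (real p)"
proof -
  have "(\<Sum>w\<in>{1..<p}. 1 / real w) \<le> (\<Sum>w\<in>{1..p}. 1 / real w)"
    by (rule sum_mono2) auto
  also have "\<dots> \<le> 1 + ln (real p)" using sum_inverse_interval_le[of 1 p] assms by simp
  finally show ?thesis .
qed

text \<open>For fixed \<open>w\<close> there are at most \<open>p / (A w)\<close> choices of
  \<open>z\<close>; summing over \<open>w\<close> gives a harmonic sum.\<close>

lemma card_hyperbola_small_le:
  assumes "2 \<le> p" "0 < A"
  shows "real (card {q \<in> hyperbola p. real (fst q) * real (snd q) \<le> real p / A})
    \<le> real p / A * (1 + ln (real p))"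
proof -
  let ?Y = "\<lambda>w. {1..nat \<lfloor>real p / A / real w\<rfloor>}"
  have "{q \<in> hyperbola p. real (fst q) * real (snd q) \<le> real p / A} \<subseteq> Sigma {1..<p} ?Y"
  proof
    fix q assume q: "q \<in> {q \<in> hyperbola p. real (fst q) * real (snd q) \<le> real p / A}"
    obtain w z where wz: "q = (w, z)" by fastforce
    have "1 \<le> w" "w < p" "1 \<le> z" using q hyperbola_subset[of p] wz by auto
    moreover have "real z \<le> real p / A / real w"
      using q wz \<open>1 \<le> w\<close> by (subst pos_le_divide_eq) (auto simp: mult.commute)
    then have "z \<le> nat \<lfloor>real p / A / real w\<rfloor>" by (rule le_nat_floor)
    ultimately show "q \<in> Sigma {1..<p} ?Y" by (simp add: wz)
  qed
  then have "card {q \<in> hyperbola p. real (fst q) * real (snd q) \<le> real p / A}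
      \<le> card (Sigma {1..<p} ?Y)"
    by (rule card_mono[rotated]) auto
  also have "\<dots> = (\<Sum>w\<in>{1..<p}. nat \<lfloor>real p / A / real w\<rfloor>)" by (subst card_SigmaI) auto
  finally have "real (card {q \<in> hyperbola p. real (fst q) * real (snd q) \<le> real p / A})
      \<le> (\<Sum>w\<in>{1..<p}. real (nat \<lfloor>real p / A / real w\<rfloor>))"
    by (subst of_nat_sum[symmetric], subst of_nat_le_iff)
  also have "\<dots> \<le> (\<Sum>w\<in>{1..<p}. real p / A * (1 / real w))"
    by (rule sum_mono) (use assms in \<open>simp add: of_nat_floor\<close>)
  also have "\<dots> = real p / A * (\<Sum>w\<in>{1..<p}. 1 / real w)" by (simp add: sum_distrib_left)
  also have "\<dots> \<le> real p / A * (1 + ln (real p))"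
    by (rule mult_left_mono[OF sum_inverse_lessThan_le]) (use assms in auto)
  finally show ?thesis .
qed

text \<open>For fixed \<open>w\<close> the values of \<open>z\<close> lie between
  \<open>p / (A w)\<close> and \<open>p / w\<close>. The ratio of these ends is \<open>A\<close> for
  every \<open>w\<close>, so the inner sum costs \<open>1 + ln A\<close> instead of a full logarithm
  of \<open>p\<close>.\<close>

lemma sum_hyperbola_large_le:
  assumes "2 \<le> p" "1 \<le> A"
  shows "(\<Sum>(w, z)\<in>{q \<in> hyperbola p. real p / A < real (fst q) * real (snd q)}.
      real p / (real w * real z)) \<le> real p * (1 + ln (real p)) * (1 + ln A)"
proof -
  let ?Y = "\<lambda>w. {z. real p / A / real w < real z \<and> real z \<le> real p / real w}"
  have fin: "finite (?Y w)" for w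
    by (rule finite_subset[of _ "{..nat \<lfloor>real p / real w\<rfloor>}"]) (auto simp: le_nat_floor)
  have sub: "{q \<in> hyperbola p. real p / A < real (fst q) * real (snd q)} \<subseteq> Sigma {1..<p} ?Y"
  proof
    fix q assume q: "q \<in> {q \<in> hyperbola p. real p / A < real (fst q) * real (snd q)}"
    obtain w z where wz: "q = (w, z)" by fastforce
    have w: "1 \<le> w" "w < p" using q hyperbola_subset[of p] wz by auto
    have "w * z < p" using q wz by (simp add: hyperbola_def)
    then have "real w * real z < real p" by (metis of_nat_less_iff of_nat_mult)
    then have "real z \<le> real p / real w" using w by (simp add: field_simps)
    moreover have "real p / A / real w < real z"
      using q wz w by (subst pos_divide_less_eq) (auto simp: mult.commute)
    ultimately show "q \<in> Sigma {1..<p} ?Y" using w by (simp add: wz)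
  qed
  have "(\<Sum>(w, z)\<in>{q \<in> hyperbola p. real p / A < real (fst q) * real (snd q)}.
      real p / (real w * real z)) \<le> (\<Sum>(w, z)\<in>Sigma {1..<p} ?Y. real p / (real w * real z))"
    by (rule sum_mono2[OF _ sub]) (use fin in auto)
  also have "\<dots> = (\<Sum>w\<in>{1..<p}. \<Sum>z\<in>?Y w. real p / (real w * real z))"
    using fin by (subst sum.Sigma) auto
  also have "\<dots> = (\<Sum>w\<in>{1..<p}. real p / real w * (\<Sum>z\<in>?Y w. 1 / real z))"
    by (simp add: sum_distrib_left)
  also have "\<dots> \<le> (\<Sum>w\<in>{1..<p}. real p / real w * (1 + ln A))"
  proof (rule sum_mono)
    fix w assume w: "w \<in> {1..<p}"
    have pos: "0 < real p / A / real w" using assms w by simp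
    have "real p / A / real w \<le> real p / real w"
      using assms w by (intro divide_right_mono) (auto simp: divide_le_eq)
    from sum_inverse_between_le[OF pos this]
    have "(\<Sum>z\<in>?Y w. 1 / real z) \<le> 1 + ln A" using assms w by simp
    then show "real p / real w * (\<Sum>z\<in>?Y w. 1 / real z) \<le> real p / real w * (1 + ln A)"
      by (rule mult_left_mono) simp
  qed
  also have "\<dots> = real p * (\<Sum>w\<in>{1..<p}. 1 / real w) * (1 + ln A)"
    by (simp add: sum_distrib_left sum_distrib_right)
  also have "\<dots> \<le> real p * (1 + ln (real p)) * (1 + ln A)"
    using assms by (intro mult_right_mono mult_left_mono sum_inverse_lessThan_le) auto
  finally show ?thesis .
qed

section \<open>Averaging the quotient sum over the residues\<close>

text \<open>Discarding the few \<open>m\<close> that have a partial quotient above roughly \<open>ln p\<close> lowers the average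
  quotient sum from order \<open>(ln p)\<^sup>2\<close> to order \<open>ln p ln ln p\<close>.\<close>

lemma exists_small_quotient_sum:
  assumes p: "prime (p :: nat)" and H: "H = 1 + ln (real p)"
  shows "\<exists>m\<in>{1..<p}. real (quotient_sum p m) \<le> 8 * H * (1 + ln (8 * H))"
proof -
  \<comment> \<open>With this \<open>A\<close> the set \<open>Sm\<close> has at most
    \<open>p / 8\<close> pairs. Each excludes at most two values of \<open>m\<close>, so at most
    \<open>p / 4\<close> are lost.\<close>
  define A where "A = 8 * H"
  define f where "f = (\<lambda>(w, z). real p / (real w * real z))"
  define Sm where "Sm = {q \<in> hyperbola p. real (fst q) * real (snd q) \<le> real p / A}"
  define La where "La = {q \<in> hyperbola p. real p / A < real (fst q) * real (snd q)}"
  define G where "G = {m \<in> {1..<p}. \<forall>q\<in>Sm. \<not> approx_pair p m q}"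
  have p2: "2 \<le> p" using p by (simp add: prime_ge_2_nat)
  then have H1: "1 \<le> H" by (simp add: H)
  have fin: "finite Sm" "finite La" using finite_hyperbola by (auto simp: Sm_def La_def)
  have fG: "finite G" by (simp add: G_def)
  have "{1..<p} \<subseteq> G \<union> (\<Union>q\<in>Sm. {m \<in> {1..<p}. approx_pair p m q})"
    by (auto simp: G_def)
  then have "card {1..<p} \<le> card (G \<union> (\<Union>q\<in>Sm. {m \<in> {1..<p}. approx_pair p m q}))"
    by (rule card_mono[rotated]) (use fin fG in auto)
  also have "\<dots> \<le> card G + card (\<Union>q\<in>Sm. {m \<in> {1..<p}. approx_pair p m q})"
    by (rule card_Un_le)
  also have "card (\<Union>q\<in>Sm. {m \<in> {1..<p}. approx_pair p m q})
      \<le> (\<Sum>q\<in>Sm. card {m \<in> {1..<p}. approx_pair p m q})"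
    by (rule card_UN_le[OF fin(1)])
  also have "\<dots> \<le> (\<Sum>q\<in>Sm. 2)"
    by (rule sum_mono, rule card_approx_pair_le[OF p]) (auto simp: Sm_def)
  finally have "p - 1 \<le> card G + 2 * card Sm" by simp
  then have "real p \<le> real (card G) + 2 * real (card Sm) + 1" using p2 by linarith
  moreover have "real (card Sm) \<le> real p / 8"
  proof -
    have "real (card Sm) \<le> real p / A * H"
      unfolding Sm_def H by (rule card_hyperbola_small_le[OF p2]) (use H1 in \<open>simp add: A_def\<close>)
    also have "\<dots> = real p / 8" using H1 by (simp add: A_def)
    finally show ?thesis .
  qed
  \<comment> \<open>What remains is at least \<open>3 p / 4 - 1\<close>, which is at least
    \<open>p / 4\<close> because \<open>p \<ge> 2\<close>.\<close>
  ultimately have cG: "real p / 4 \<le> real (card G)" using p2 by linarith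

  have "(\<Sum>m\<in>G. real (quotient_sum p m)) \<le> (\<Sum>m\<in>G. \<Sum>q | q \<in> La \<and> approx_pair p m q. f q)"
  proof (rule sum_mono)
    fix m assume m: "m \<in> G"
    have "{q \<in> hyperbola p. approx_pair p m q} = {q. q \<in> La \<and> approx_pair p m q}"
      using m by (force simp: G_def Sm_def La_def)
    then show "real (quotient_sum p m) \<le> (\<Sum>q | q \<in> La \<and> approx_pair p m q. f q)"
      using quotient_sum_le[of m p] m by (simp add: G_def f_def)
  qed
  also have "\<dots> = (\<Sum>q\<in>La. \<Sum>m | m \<in> G \<and> approx_pair p m q. f q)"
    by (rule sum.swap_restrict[OF fG fin(2)])
  also have "\<dots> \<le> (\<Sum>q\<in>La. 2 * f q)"
  proof (rule sum_mono)
    fix q assume q: "q \<in> La"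
    have "card {m. m \<in> G \<and> approx_pair p m q} \<le> card {m \<in> {1..<p}. approx_pair p m q}"
      by (rule card_mono) (auto simp: G_def)
    also have "\<dots> \<le> 2" using card_approx_pair_le[OF p] q by (simp add: La_def)
    finally have "real (card {m. m \<in> G \<and> approx_pair p m q}) * f q \<le> 2 * f q"
      by (intro mult_right_mono) (auto simp: f_def split: prod.split)
    then show "(\<Sum>m | m \<in> G \<and> approx_pair p m q. f q) \<le> 2 * f q" by simp
  qed
  also have "\<dots> = 2 * (\<Sum>q\<in>La. f q)" by (simp add: sum_distrib_left)
  also have "\<dots> \<le> 2 * (real p * H * (1 + ln A))"
    unfolding La_def f_def H
    by (intro mult_left_mono sum_hyperbola_large_le[OF p2]) (use H1 in \<open>auto simp: A_def\<close>)
  finally have S: "(\<Sum>m\<in>G. real (quotient_sum p m)) \<le> 2 * (real p * H * (1 + ln A))" .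

  show ?thesis
  proof (rule ccontr)
    assume "\<not> ?thesis"
    then have less: "8 * H * (1 + ln A) < real (quotient_sum p m)" if "m \<in> G" for m
      using that by (auto simp: A_def G_def not_le)
    have "G \<noteq> {}" using cG p2 by auto
    have "0 \<le> 1 + ln A" using H1 by (simp add: A_def)
    \<comment> \<open>If every \<open>m\<close> in \<open>G\<close> exceeded the bound, the sum over
      \<open>G\<close> would exceed \<open>p / 4\<close> times it, which is exactly the upper bound
      in \<open>S\<close>.\<close>
    then have "real p / 4 * (8 * H * (1 + ln A)) \<le> real (card G) * (8 * H * (1 + ln A))"
      using cG H1 by (intro mult_right_mono) auto
    also have "\<dots> = (\<Sum>m\<in>G. 8 * H * (1 + ln A))" by simp
    also have "\<dots> < (\<Sum>m\<in>G. real (quotient_sum p m))"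
      by (rule sum_strict_mono[OF fG \<open>G \<noteq> {}\<close>]) (rule less)
    also note S
    finally show False by simp
  qed
qed

text \<open>The iterated logarithm is made uniform in \<open>p \<le> N\<close>, so that the costs
  are a fixed multiple of \<open>ln p\<close> and add up over a factorization. Since
  \<open>ln p \<ge> 2/3\<close>, the factor \<open>8 (1 + ln p)\<close> is at most
  \<open>24 ln p\<close>.\<close>

lemma exists_small_quotient_sum_ln:
  assumes p: "prime (p :: nat)" and "p \<le> N"
  shows "\<exists>m\<in>{1..<p}. real (quotient_sum p m) \<le> 24 * (1 + ln (8 * (1 + ln (real N)))) * ln (real p)"
proof -
  obtain m where m: "m \<in> {1..<p}"
    "real (quotient_sum p m) \<le> 8 * (1 + ln (real p)) * (1 + ln (8 * (1 + ln (real p))))"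
    using exists_small_quotient_sum[OF p refl] by blast
  have p2: "2 \<le> p" using p by (simp add: prime_ge_2_nat)
  have "2 / 3 \<le> ln (2 :: real)" by (rule ln2_ge_two_thirds)
  also have "\<dots> \<le> ln (real p)" using p2 by simp
  finally have ln_p: "2 / 3 \<le> ln (real p)" .
  then have "8 * (1 + ln (real p)) \<le> 24 * ln (real p)" by simp
  moreover have "ln (8 * (1 + ln (real p))) \<le> ln (8 * (1 + ln (real N)))"
  proof (rule ln_mono)
    show "8 * (1 + ln (real p)) \<le> 8 * (1 + ln (real N))" using p2 assms(2) by simp
    show "0 < 8 * (1 + ln (real p))" using ln_p by simp
  qed
  moreover have "0 \<le> ln (8 * (1 + ln (real p)))"
    using ln_p by (intro ln_ge_zero) simp
  ultimately have "8 * (1 + ln (real p)) * (1 + ln (8 * (1 + ln (real p))))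
      \<le> 24 * ln (real p) * (1 + ln (8 * (1 + ln (real N))))"
    by (intro mult_mono[of "8 * (1 + ln (real p))"]) (use ln_p in auto)
  with m show ?thesis by (intro bexI[of _ m]) (auto simp: mult_ac)
qed

section \<open>Induction over the prime factors and the final estimate\<close>

text \<open>Treating the prime factors of \<open>k\<close> one at a time means that only prime moduli \<open>p\<close> occur, for
  which every \<open>m\<close> is coprime to \<open>p\<close>.\<close>

lemma in_LE_of_prime_bound:
  fixes D :: real
  assumes D: "\<And>p. prime p \<Longrightarrow> p \<le> N \<Longrightarrow> \<exists>m\<in>{1..<p}. real (quotient_sum p m) \<le> D * ln (real p)"
    and "0 < k" "k \<le> N" "D * ln (real k) \<le> real n"
  shows "k \<in> LE n"
  using assms(2-)
proof (induction k arbitrary: n rule: less_induct)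
  case (less k)
  show ?case
  proof (cases "k = 1")
    case True
    then show ?thesis using one_in_LE by simp
  next
    case False
    then obtain p where p: "prime p" "p dvd k" using prime_factor_nat by blast
    then obtain j where j: "k = j * p" by (metis dvdE mult.commute)
    have p2: "2 \<le> p" using p(1) by (simp add: prime_ge_2_nat)
    have "0 < j" using j less.prems(1) by simp
    have "p \<le> N" using p(2) less.prems by (meson dvd_imp_le le_trans)
    then obtain m where m: "m \<in> {1..<p}" "real (quotient_sum p m) \<le> D * ln (real p)"
      using D p(1) by blast
    have ln: "D * ln (real k) = D * ln (real j) + D * ln (real p)"
      using j \<open>0 < j\<close> p2 by (simp add: ln_mult algebra_simps)
    \<comment> \<open>No sign of \<open>D\<close> is assumed; it follows from the bound at
      \<open>p\<close>, as a quotient sum is nonnegative.\<close>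
    have "D * ln 2 \<ge> 0"
    proof -
      have "0 \<le> D * ln (real p)" using m(2) by (rule order.trans[rotated]) simp
      moreover have "0 < ln (real p)" using p2 by simp
      ultimately show ?thesis by (simp add: zero_le_mult_iff)
    qed
    then have "0 \<le> D * ln (real j)" using \<open>0 < j\<close> by (simp add: zero_le_mult_iff)
    then have qn: "quotient_sum p m \<le> n" using m(2) ln less.prems(3) by linarith
    have "j < k" using j \<open>0 < j\<close> p2 by simp
    moreover have "D * ln (real j) \<le> real (n - quotient_sum p m)"
      using m(2) ln less.prems(3) qn by (simp add: of_nat_diff)
    ultimately have "j \<in> LE (n - quotient_sum p m)"
      using less.IH[of j] \<open>0 < j\<close> less.prems(2) by simp
    moreover have "coprime p m"
      using p(1) m(1) by (intro prime_imp_coprime) (auto simp: nat_dvd_not_less)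
    ultimately have "j * p \<in> LE (n - quotient_sum p m + quotient_sum p m)"
      using m(1) by (intro LE_mult) auto
    then show ?thesis using qn j by simp
  qed
qed

theorem theorem1p1:
  shows "\<exists>c::real. c > 0 \<and> (\<exists>n0::nat. \<forall>n\<ge>n0. \<forall>k::nat.
            0 < k \<and> real k \<le> exp (c * real n / ln (real n)) \<longrightarrow> k \<in> LE n)"
proof (intro exI[of _ "1/48 :: real"] conjI exI[of _ "16 :: nat"] allI impI)
  fix n k :: nat
  assume n: "16 \<le> n" and k: "0 < k \<and> real k \<le> exp (1/48 * real n / ln (real n))"
  let ?D = "24 * (1 + ln (8 * (1 + ln (real k))))"
  have "exp 1 \<le> real n" using exp_le n by linarith
  then have ln1: "1 \<le> ln (real n)" using n by (simp add: ln_ge_iff)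
  have "ln (real k) \<le> ln (exp (1/48 * real n / ln (real n)))" using k by (intro ln_mono) auto
  then have lnk: "ln (real k) \<le> real n / 48 / ln (real n)" by simp
  \<comment> \<open>Hence \<open>8 (1 + ln k) \<le> 8 + n / 6\<close>, which is at most
    \<open>n\<close> for \<open>n \<ge> 16\<close>.\<close>
  also have "\<dots> \<le> real n / 48 / 1" using ln1 by (intro divide_left_mono) auto
  finally have le: "8 * (1 + ln (real k)) \<le> real n" using n by simp
  have k0: "0 \<le> ln (real k)" using k by simp
  have "ln (8 * (1 + ln (real k))) \<le> ln (real n)" using le k0 by (intro ln_mono) auto
  \<comment> \<open>This is where 48 comes from: \<open>24 (1 + ln n) \<le> 48 ln n\<close> because
    \<open>ln n \<ge> 1\<close>.\<close>
  then have "?D \<le> 48 * ln (real n)" using ln1 by simp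
  then have "?D * ln (real k) \<le> 48 * ln (real n) * (real n / 48 / ln (real n))"
    by (rule mult_mono) (use lnk k0 ln1 in auto)
  also have "\<dots> = real n" using ln1 by simp
  finally have "?D * ln (real k) \<le> real n" .
  with k show "k \<in> LE n"
    by (intro in_LE_of_prime_bound[where N = k and D = ?D] exists_small_quotient_sum_ln) auto
qed simp

end
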